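(* Let $c>0$, $n,N\ge 1$, and let $\nu_1,\dots,\nu_N\ge 0$ be real weights that are not all zero. Let $\bm{b}_1,\dots,\bm{b}_N\in\mathbb{B}^n_c$, and let $\bm{n}_i\in\mathbb{K}^n_c$ and $\bm{h}_i\in\mathbb{H}^n_c$ be the points corresponding to $\bm{b}_i$ in the Beltrami-Klein model and in the hyperboloid model, respectively, i.e. $\bm{n}_i=\phi_{\mathbb{K}}(\bm{b}_i)$ and $\bm{h}_i=\phi_{\mathbb{H}}(\bm{b}_i)$. Let $\bar{\bm{b}}\in\mathbb{B}^n_c$ be the Möbius gyromidpoint of $(\bm{b}_i,\nu_i)_{i=1}^N$, let $\bar{\bm{n}}\in\mathbb{K}^n_c$ be the Einstein gyromidpoint of $(\bm{n}_i,\nu_i)_{i=1}^N$, and let $\bar{\bm{h}}\in\mathbb{H}^n_c$ be the centroid of the squared Lorentzian distance of $(\bm{h}_i,\nu_i)_{i=1}^N$. Then the three midpoints are the same point expressed in the three models: $\bar{\bm{n}}=\phi_{\mathbb{K}}(\bar{\bm{b}})$ and $\bar{\bm{h}}=\phi_{\mathbb{H}}(\bar{\bm{b}})$.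
   Context: Fix $c>0$ (the curvature is $-c$). $\|\cdot\|$ and $\langle\cdot,\cdot\rangle$ denote the Euclidean norm and inner product. Models. Poincaré ball: $\mathbb{B}^n_c=\{\bm{x}\in\mathbb{R}^n: c\|\bm{x}\|^2<1\}$. Beltrami-Klein model: $\mathbb{K}^n_c=\{\bm{x}\in\mathbb{R}^n: c\|\bm{x}\|^2<1\}$ (same set, different metric). Hyperboloid model: $\mathbb{H}^n_c=\{\bm{x}=(x_0,\dots,x_n)\in\mathbb{R}^{n+1}: c\langle\bm{x},\bm{x}\rangle_{\mathcal L}=-1,\ x_0>0\}$, where $\langle\bm{x},\bm{y}\rangle_{\mathcal L}=-x_0y_0+\sum_{j=1}^n x_jy_j$. Identifications (bijections): $\phi_{\mathbb{K}}:\mathbb{B}^n_c\to\mathbb{K}^n_c$, $\phi_{\mathbb{K}}(\bm{b})=\dfrac{2\bm{b}}{1+c\|\bm{b}\|^2}$, with inverse $\bm{n}\mapsto \dfrac{\bm{n}}{1+\sqrt{1-c\|\bm{n}\|^2}}$; and $\phi_{\mathbb{H}}:\mathbb{B}^n_c\to\mathbb{H}^n_c$, $\phi_{\mathbb{H}}(\bm{b})=\left(\dfrac{1}{\sqrt c}\dfrac{1+c\|\bm{b}\|^2}{1-c\|\bm{b}\|^2},\ \dfrac{2\bm{b}}{1-c\|\bm{b}\|^2}\right)\in\mathbb{R}\times\mathbb{R}^n$, with inverse $(z,\bm{k})\mapsto\dfrac{\bm{k}}{1+\sqrt c\,z}$. Conformal factor: $\lambda^c_{\bm{b}}=2/(1-c\|\bm{b}\|^2)$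 for $\bm{b}\in\mathbb{B}^n_c$. Möbius scalar multiplication: for $r\in\mathbb{R}$ and $\bm{x}\in\mathbb{B}^n_c\setminus\{\bm 0\}$, $r\otimes_c\bm{x}=\frac{1}{\sqrt c}\tanh\left(r\tanh^{-1}(\sqrt c\|\bm{x}\|)\right)\frac{\bm{x}}{\|\bm{x}\|}$, and $r\otimes_c\bm{0}=\bm{0}$. Midpoints (weights $\nu_i\ge0$, not all zero): Möbius gyromidpoint of $(\bm{b}_i,\nu_i)$: $\displaystyle \bar{\bm{b}}=\frac12\otimes_c\left(\frac{\sum_{i=1}^N\nu_i\lambda^c_{\bm{b}_i}\bm{b}_i}{\sum_{i=1}^N\nu_i(\lambda^c_{\bm{b}_i}-1)}\right)$. Einstein gyromidpoint of $(\bm{n}_i,\nu_i)$: $\displaystyle\bar{\bm{n}}=\frac{\sum_{i=1}^N\nu_i\gamma_i\bm{n}_i}{\sum_{i=1}^N\nu_i\gamma_i}$, where $\gamma_i=\dfrac{1}{\sqrt{1-c\|\bm{n}_i\|^2}}$. Centroid of the squared Lorentzian distance of $(\bm{h}_i,\nu_i)$: $\displaystyle\bar{\bm{h}}=\frac{\underline{\bm{h}}}{\sqrt c\,\sqrt{|\langle\underline{\bm{h}},\underline{\bm{h}}\rangle_{\mathcal L}|}}$ with $\underline{\bm{h}}=\sum_{i=1}^N\nu_i\bm{h}_i$; this is the known closed form of the minimizer over $\tilde{\bm{h}}\in\mathbb{H}^n_c$ of $\sum_{i=1}^N\nu_i\langle\bm{h}_i-\tilde{\bm{h}},\bm{h}_i-\tilde{\bm{h}}\rangle_{\mathcal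 L}$. *)

theory Defs
  imports "HOL-Analysis.Analysis"
begin

text \<open>
  Throughout, \<open>c > 0\<close> and the curvature is \<open>- c\<close>. The space \<open>\<real>\<^sup>n\<close> is \<open>real ^ 'n\<close>, and the ambient
  space \<open>\<real>\<^sup>n\<^sup>+\<^sup>1 = \<real> \<times> \<real>\<^sup>n\<close> of the hyperboloid is \<open>real \<times> real ^ 'n\<close>, with the time coordinate
  \<open>x\<^sub>0\<close> as first component.
\<close>

definition poincare_ball :: "real \<Rightarrow> (real ^ 'n) set" where
  "poincare_ball c = {x. c * (norm x)\<^sup>2 < 1}"

definition klein_model :: "real \<Rightarrow> (real ^ 'n) set" where
  "klein_model c = {x. c * (norm x)\<^sup>2 < 1}"

definition lorentz_inner :: "real \<times> (real ^ 'n) \<Rightarrow> real \<times> (real ^ 'n) \<Rightarrow> real" where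
  "lorentz_inner x y = - (fst x * fst y) + snd x \<bullet> snd y"

definition hyperboloid :: "real \<Rightarrow> (real \<times> (real ^ 'n)) set" where
  "hyperboloid c = {x. c * lorentz_inner x x = - 1 \<and> fst x > 0}"

definition to_klein :: "real \<Rightarrow> real ^ 'n \<Rightarrow> real ^ 'n" where
  "to_klein c b = (2 / (1 + c * (norm b)\<^sup>2)) *\<^sub>R b"

definition to_hyperboloid :: "real \<Rightarrow> real ^ 'n \<Rightarrow> real \<times> (real ^ 'n)" where
  "to_hyperboloid c b =
    (1 / sqrt c * ((1 + c * (norm b)\<^sup>2) / (1 - c * (norm b)\<^sup>2)),
     (2 / (1 - c * (norm b)\<^sup>2)) *\<^sub>R b)"

definition conformal_factor :: "real \<Rightarrow> real ^ 'n \<Rightarrow> real" where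
  "conformal_factor c b = 2 / (1 - c * (norm b)\<^sup>2)"

definition lorentz_factor :: "real \<Rightarrow> real ^ 'n \<Rightarrow> real" where
  "lorentz_factor c x = 1 / sqrt (1 - c * (norm x)\<^sup>2)"

definition mobius_scale :: "real \<Rightarrow> real \<Rightarrow> real ^ 'n \<Rightarrow> real ^ 'n" where
  "mobius_scale c r x =
    (if x = 0 then 0
     else (1 / sqrt c * tanh (r * artanh (sqrt c * norm x))) *\<^sub>R (x /\<^sub>R norm x))"

definition mobius_gyromidpoint ::
    "real \<Rightarrow> nat \<Rightarrow> (nat \<Rightarrow> real) \<Rightarrow> (nat \<Rightarrow> real ^ 'n) \<Rightarrow> real ^ 'n" where
  "mobius_gyromidpoint c N \<nu> b =
    mobius_scale c (1 / 2)
      ((\<Sum>i=1..N. (\<nu> i * conformal_factor c (b i)) *\<^sub>R b i)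
        /\<^sub>R (\<Sum>i=1..N. \<nu> i * (conformal_factor c (b i) - 1)))"

definition einstein_gyromidpoint ::
    "real \<Rightarrow> nat \<Rightarrow> (nat \<Rightarrow> real) \<Rightarrow> (nat \<Rightarrow> real ^ 'n) \<Rightarrow> real ^ 'n" where
  "einstein_gyromidpoint c N \<nu> x =
    (\<Sum>i=1..N. (\<nu> i * lorentz_factor c (x i)) *\<^sub>R x i)
      /\<^sub>R (\<Sum>i=1..N. \<nu> i * lorentz_factor c (x i))"

text \<open>
  The closed form of the minimiser over \<open>y \<in> hyperboloid c\<close> of
  \<open>\<Sum>i=1..N. \<nu> i * lorentz_inner (h i - y) (h i - y)\<close>.
\<close>

definition lorentz_centroid ::
    "real \<Rightarrow> nat \<Rightarrow> (nat \<Rightarrow> real) \<Rightarrow> (nat \<Rightarrow> real \<times> (real ^ 'n)) \<Rightarrow> real \<times> (real ^ 'n)" where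
  "lorentz_centroid c N \<nu> h =
    (let s = (\<Sum>i=1..N. \<nu> i *\<^sub>R h i)
     in s /\<^sub>R (sqrt c * sqrt \<bar>lorentz_inner s s\<bar>))"

end

theory Submission
  imports Defs
begin

text \<open>
  All three midpoints come from the same vector \<open>m = S / T\<close> with \<open>S = \<Sum> \<nu>\<^sub>i \<lambda>\<^sub>i b\<^sub>i\<close> and
  \<open>T = \<Sum> \<nu>\<^sub>i (\<lambda>\<^sub>i - 1)\<close>. In the Klein model \<open>\<gamma>\<^sub>i = \<lambda>\<^sub>i - 1\<close> and \<open>\<gamma>\<^sub>i n\<^sub>i = \<lambda>\<^sub>i b\<^sub>i\<close>, so \<open>m\<close> is the
  Einstein gyromidpoint; on the hyperboloid the weighted sum is \<open>(T / \<surd>c, S)\<close>, which normalises to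
  the hyperboloid point above \<open>m\<close>. Finally \<open>1/2 \<otimes> m = m / (1 + \<surd>(1 - c \<parallel>m\<parallel>\<^sup>2))\<close> is the inverse of the
  identification of the Poincare ball with the Klein model.
\<close>

text \<open>On this interval \<open>artanh x = ln y\<close> with
  \<open>y = sqrt ((1 + x) / (1 - x))\<close>, and \<open>tanh (ln y)\<close> is a rational function
  of \<open>y\<^sup>2\<close>.\<close>

lemma tanh_artanh_real:
  fixes x :: real
  assumes "\<bar>x\<bar> < 1"
  shows "tanh (artanh x) = x"
proof -
  have pos: "(1 + x) / (1 - x) > 0"
    using assms by simp
  then have "artanh x = ln (sqrt ((1 + x) / (1 - x)))"
    by (simp add: artanh_def ln_sqrt)
  then show ?thesis
    using pos assms by (simp add: tanh_ln_real) (simp add: field_simps)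
qed

text \<open>Half-argument formula: \<open>t = x / (1 + w)\<close> with
  \<open>w = sqrt (1 - x\<^sup>2)\<close> solves \<open>2 * t / (1 + t\<^sup>2) = x\<close>, so the
  doubling formula for \<open>tanh\<close> gives \<open>artanh x = 2 * artanh t\<close>.\<close>

lemma tanh_half_artanh:
  fixes x :: real
  assumes "\<bar>x\<bar> < 1"
  shows "tanh (artanh x / 2) = x / (1 + sqrt (1 - x\<^sup>2))"
proof -
  define w where "w = sqrt (1 - x\<^sup>2)"
  define t where "t = x / (1 + w)"
  have "x\<^sup>2 < 1"
    using assms by (simp add: abs_square_less_1)
  then have w: "w > 0" "w\<^sup>2 = 1 - x\<^sup>2"
    by (simp_all add: w_def)
  \<comment> \<open>This puts \<open>t\<close> in the domain where \<open>tanh\<close> undoes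
    \<open>artanh\<close>.\<close>
  have "\<bar>t\<bar> < 1"
    using assms w(1) by (simp add: t_def abs_if field_simps split: if_splits)
  then have t: "tanh (artanh t) = t"
    by (simp add: tanh_artanh_real)
  have t2: "1 + t\<^sup>2 = 2 / (1 + w)"
  proof -
    have "(1 + w)\<^sup>2 + x\<^sup>2 = 2 * (1 + w)"
      using w(2) by (simp add: power2_sum)
    then have "1 + t\<^sup>2 = 2 * (1 + w) / (1 + w)\<^sup>2"
      using w(1) by (simp add: t_def field_simps)
    also have "\<dots> = 2 / (1 + w)"
      using w(1) by (simp add: power2_eq_square divide_simps)
    finally show ?thesis .
  qed
  have "tanh (2 * artanh t) = 2 * t / (1 + t\<^sup>2)"
    using tanh_add[of "artanh t" "artanh t"]
    by (simp add: t power2_eq_square)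
  also have "\<dots> = x"
    using w(1) by (simp add: t2) (simp add: t_def)
  finally have "artanh x = 2 * artanh t"
    by (metis artanh_tanh_real)
  then show ?thesis
    using t by (simp add: t_def w_def)
qed

text \<open>The half-argument formula at \<open>sqrt c * norm x\<close> produces a factor
  \<open>sqrt c * norm x\<close>, which cancels the normalisations in \<open>mobius_scale\<close>;
  the result also covers \<open>x = 0\<close>, so no case split survives.\<close>

lemma mobius_scale_half:
  fixes x :: "real ^ 'n"
  assumes "c > 0" "c * (norm x)\<^sup>2 < 1"
  shows "mobius_scale c (1 / 2) x = x /\<^sub>R (1 + sqrt (1 - c * (norm x)\<^sup>2))"
proof (cases "x = 0")
  case True
  then show ?thesis by (simp add: mobius_scale_def)
next
  case False
  have sq: "(sqrt c * norm x)\<^sup>2 = c * (norm x)\<^sup>2"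
    using assms(1) by (simp add: power_mult_distrib)
  then have "\<bar>sqrt c * norm x\<bar> < 1"
    using assms(2) by (metis abs_square_less_1)
  then have tanh: "tanh (1 / 2 * artanh (sqrt c * norm x)) =
      sqrt c * norm x / (1 + sqrt (1 - c * (norm x)\<^sup>2))"
    using tanh_half_artanh[of "sqrt c * norm x"] unfolding sq by simp
  have "1 / sqrt c * (sqrt c * norm x / q) * inverse (norm x) = inverse q" for q
    using assms(1) False by (simp add: inverse_eq_divide)
  then show ?thesis
    using False unfolding mobius_scale_def tanh scaleR_scaleR by (simp only: if_False)
qed

text \<open>Since \<open>c * (norm x)\<^sup>2 = 1 - w\<^sup>2 = (1 - w) * (1 + w)\<close>, one
  factor \<open>1 + w\<close> cancels.\<close>

lemma half_scale_norm:
  fixes x :: "real ^ 'n"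
  assumes "c * (norm x)\<^sup>2 < 1"
  defines "w \<equiv> sqrt (1 - c * (norm x)\<^sup>2)"
  shows "c * (norm (x /\<^sub>R (1 + w)))\<^sup>2 = (1 - w) / (1 + w)"
proof -
  have w: "w > 0" "w\<^sup>2 = 1 - c * (norm x)\<^sup>2"
    using assms(1) by (simp_all add: w_def)
  have "c * (norm (x /\<^sub>R (1 + w)))\<^sup>2 = c * (norm x)\<^sup>2 / (1 + w)\<^sup>2"
    using w(1) by (simp add: power_divide power_mult_distrib divide_inverse power_inverse)
  also have "\<dots> = ((1 - w) * (1 + w)) / ((1 + w) * (1 + w))"
    using w(2) by (simp add: power2_eq_square algebra_simps)
  finally show ?thesis
    using w(1) by simp
qed

text \<open>For the halved point, \<open>1 + c * (norm b)\<^sup>2\<close> and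
  \<open>1 - c * (norm b)\<^sup>2\<close> become \<open>2 / (1 + w)\<close> and
  \<open>2 * w / (1 + w)\<close>. Both identifications then lose the factor \<open>1 + w\<close>,
  leaving \<open>x\<close> in the Klein model and the factor \<open>1 / w\<close>, the Lorentz
  factor, on the hyperboloid.\<close>

lemma
  fixes x :: "real ^ 'n"
  assumes "c > 0" "c * (norm x)\<^sup>2 < 1"
  shows mobius_half_in_ball: "mobius_scale c (1 / 2) x \<in> poincare_ball c"
    and to_klein_mobius_half: "to_klein c (mobius_scale c (1 / 2) x) = x"
    and to_hyperboloid_mobius_half: "to_hyperboloid c (mobius_scale c (1 / 2) x) =
      (lorentz_factor c x / sqrt c, lorentz_factor c x *\<^sub>R x)"
proof -
  define w where "w = sqrt (1 - c * (norm x)\<^sup>2)"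
  have w: "w > 0"
    using assms(2) by (simp add: w_def)
  have half: "mobius_scale c (1 / 2) x = x /\<^sub>R (1 + w)"
    using mobius_scale_half[OF assms] by (simp add: w_def)
  have norm: "c * (norm (x /\<^sub>R (1 + w)))\<^sup>2 = (1 - w) / (1 + w)"
    using half_scale_norm[OF assms(2)] by (simp add: w_def)
  have sum: "1 + (1 - w) / (1 + w) = 2 / (1 + w)" and diff: "1 - (1 - w) / (1 + w) = 2 * w / (1 + w)"
    using w by (simp_all add: field_simps)
  show "mobius_scale c (1 / 2) x \<in> poincare_ball c"
    unfolding half poincare_ball_def mem_Collect_eq norm using w by simp
  show "to_klein c (mobius_scale c (1 / 2) x) = x"
    unfolding half to_klein_def norm sum using w by (simp flip: divide_inverse)
  show "to_hyperboloid c (mobius_scale c (1 / 2) x) =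
      (lorentz_factor c x / sqrt c, lorentz_factor c x *\<^sub>R x)"
    unfolding half to_hyperboloid_def norm sum diff
  proof -
    have "2 / (1 + w) / (2 * w / (1 + w)) = 1 / w"
      and "2 / (2 * w / (1 + w)) * inverse (1 + w) = 1 / w"
      using w by (simp_all add: divide_simps)
    then show "(1 / sqrt c * (2 / (1 + w) / (2 * w / (1 + w))),
        (2 / (2 * w / (1 + w))) *\<^sub>R (x /\<^sub>R (1 + w))) =
        (lorentz_factor c x / sqrt c, lorentz_factor c x *\<^sub>R x)"
      by (simp only: scaleR_scaleR lorentz_factor_def w_def[symmetric]) simp
  qed
qed

text \<open>The Lorentzian norm reduces to
  \<open>4 * u - (1 + u)\<^sup>2 = - (1 - u)\<^sup>2\<close>.\<close>

lemma to_hyperboloid_in_hyperboloid: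
  fixes b :: "real ^ 'n"
  assumes "c > 0" "b \<in> poincare_ball c"
  shows "to_hyperboloid c b \<in> hyperboloid c"
proof -
  define u where "u = c * (norm b)\<^sup>2"
  have u: "0 \<le> u" "u < 1"
    using assms by (simp_all add: u_def poincare_ball_def)
  have inner: "lorentz_inner (p, q *\<^sub>R b) (p, q *\<^sub>R b) = - p\<^sup>2 + q\<^sup>2 * (norm b)\<^sup>2" for p q
    unfolding power2_norm_eq_inner by (simp add: lorentz_inner_def power2_eq_square)
  have "c * lorentz_inner (to_hyperboloid c b) (to_hyperboloid c b) =
      - (c * (1 / sqrt c)\<^sup>2) * ((1 + u) / (1 - u))\<^sup>2 + (2 / (1 - u))\<^sup>2 * u"
    unfolding to_hyperboloid_def inner power_mult_distrib
    by (simp add: right_diff_distrib u_def)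
  also have "c * (1 / sqrt c)\<^sup>2 = 1"
    using assms(1) by (simp add: power_divide)
  also have "- 1 * ((1 + u) / (1 - u))\<^sup>2 + (2 / (1 - u))\<^sup>2 * u = (4 * u - (1 + u)\<^sup>2) / (1 - u)\<^sup>2"
    by (simp add: power_divide diff_divide_distrib)
  also have "4 * u - (1 + u)\<^sup>2 = - (1 - u)\<^sup>2"
    by (simp add: power2_eq_square algebra_simps)
  finally show ?thesis
    using u assms(1) by (simp add: hyperboloid_def to_hyperboloid_def u_def[symmetric])
qed

text \<open>The quantity under the root is the perfect square
  \<open>((1 - u) / (1 + u))\<^sup>2\<close>, so the Lorentz factor is rational in
  \<open>u\<close>.\<close>

lemma lorentz_factor_to_klein:
  fixes b :: "real ^ 'n"
  assumes "c > 0" "b \<in> poincare_ball c"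
  shows "lorentz_factor c (to_klein c b) = conformal_factor c b - 1"
    and "lorentz_factor c (to_klein c b) *\<^sub>R to_klein c b = conformal_factor c b *\<^sub>R b"
proof -
  define u where "u = c * (norm b)\<^sup>2"
  have u: "0 \<le> u" "u < 1"
    using assms by (simp_all add: u_def poincare_ball_def)
  have "1 - c * (norm (to_klein c b))\<^sup>2 = 1 - 4 * u / (1 + u)\<^sup>2"
    by (simp add: to_klein_def u_def power_mult_distrib power_divide)
  also have "\<dots> = ((1 + u)\<^sup>2 - 4 * u) / (1 + u)\<^sup>2"
    using u by (simp add: diff_divide_distrib)
  also have "(1 + u)\<^sup>2 - 4 * u = (1 - u)\<^sup>2"
    by (simp add: power2_eq_square algebra_simps)
  also have "(1 - u)\<^sup>2 / (1 + u)\<^sup>2 = ((1 - u) / (1 + u))\<^sup>2"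
    by (simp add: power_divide)
  finally have "lorentz_factor c (to_klein c b) = (1 + u) / (1 - u)"
    using u by (simp add: lorentz_factor_def)
  moreover have "(1 + u) / (1 - u) = 2 / (1 - u) - 1"
    using u by (simp add: field_simps)
  ultimately show "lorentz_factor c (to_klein c b) = conformal_factor c b - 1"
    by (simp add: conformal_factor_def u_def)
  show "lorentz_factor c (to_klein c b) *\<^sub>R to_klein c b = conformal_factor c b *\<^sub>R b"
    unfolding \<open>lorentz_factor c (to_klein c b) = (1 + u) / (1 - u)\<close>
    using u by (simp add: conformal_factor_def to_klein_def divide_simps flip: u_def)
qed

lemma to_hyperboloid_conformal:
  assumes "b \<in> poincare_ball c"
  shows "to_hyperboloid c b = ((conformal_factor c b - 1) / sqrt c, conformal_factor c b *\<^sub>R b)"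
proof -
  have "(1 + c * (norm b)\<^sup>2) / (1 - c * (norm b)\<^sup>2) = 2 / (1 - c * (norm b)\<^sup>2) - 1"
    using assms by (simp add: poincare_ball_def divide_simps)
  then show ?thesis
    by (simp add: to_hyperboloid_def conformal_factor_def)
qed

text \<open>With \<open>r = sqrt c * norm b\<close> this is \<open>(1 - r)\<^sup>2 > 0\<close> in
  disguise. Geometrically, the hyperboloid point of \<open>b\<close> lies strictly inside the future
  light cone; weighted sums inherit this.\<close>

lemma conformal_factor_norm_less:
  assumes "c > 0" "b \<in> poincare_ball c"
  shows "sqrt c * norm (conformal_factor c b *\<^sub>R b) < conformal_factor c b - 1"
proof -
  define r where "r = sqrt c * norm b"
  have r2: "r\<^sup>2 = c * (norm b)\<^sup>2"
    using assms(1) by (simp add: r_def power_mult_distrib)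
  then have lt: "r\<^sup>2 < 1"
    using assms(2) by (simp add: poincare_ball_def)
  then have "r \<noteq> 1" by auto
  then have "(1 - r)\<^sup>2 > 0" by simp
  then have "2 * r < 1 + r\<^sup>2"
    by (simp add: power2_diff)
  then have "2 * r / (1 - r\<^sup>2) < (1 + r\<^sup>2) / (1 - r\<^sup>2)"
    using lt by (simp add: divide_strict_right_mono)
  also have "\<dots> = 2 / (1 - r\<^sup>2) - 1"
    using lt by (simp add: field_simps)
  finally show ?thesis
    using lt by (simp add: conformal_factor_def r2[symmetric] r_def mult.left_commute mult.commute)
qed

theorem theorem1:
  fixes c :: real and N :: nat and \<nu> :: "nat \<Rightarrow> real"
    and b :: "nat \<Rightarrow> real ^ 'n" and k :: "nat \<Rightarrow> real ^ 'n"
    and h :: "nat \<Rightarrow> real \<times> (real ^ 'n)"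
    and b_bar k_bar :: "real ^ 'n" and h_bar :: "real \<times> (real ^ 'n)"
  assumes "c > 0" and "N \<ge> 1"
    and "\<And>i. i \<in> {1..N} \<Longrightarrow> \<nu> i \<ge> 0"
    and "\<exists>i\<in>{1..N}. \<nu> i \<noteq> 0"
    and "\<And>i. i \<in> {1..N} \<Longrightarrow> b i \<in> poincare_ball c"
    and "\<And>i. i \<in> {1..N} \<Longrightarrow> k i = to_klein c (b i)"
    and "\<And>i. i \<in> {1..N} \<Longrightarrow> h i = to_hyperboloid c (b i)"
    and "b_bar = mobius_gyromidpoint c N \<nu> b"
    and "k_bar = einstein_gyromidpoint c N \<nu> k"
    and "h_bar = lorentz_centroid c N \<nu> h"
  shows "b_bar \<in> poincare_ball c \<and> k_bar \<in> klein_model c \<and> h_bar \<in> hyperboloid c \<and>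
         k_bar = to_klein c b_bar \<and> h_bar = to_hyperboloid c b_bar"
proof -
  define S where "S = (\<Sum>i=1..N. (\<nu> i * conformal_factor c (b i)) *\<^sub>R b i)"
  define T where "T = (\<Sum>i=1..N. \<nu> i * (conformal_factor c (b i) - 1))"
  define m where "m = S /\<^sub>R T"
  \<comment> \<open>The triangle inequality, with nonnegative weights pulled out of the
    norms.\<close>
  have "sqrt c * norm S \<le> (\<Sum>i=1..N. \<nu> i * (sqrt c * norm (conformal_factor c (b i) *\<^sub>R b i)))"
  proof -
    have "norm S \<le> (\<Sum>i=1..N. norm ((\<nu> i * conformal_factor c (b i)) *\<^sub>R b i))"
      unfolding S_def by (rule norm_sum)
    also have "\<dots> = (\<Sum>i=1..N. \<nu> i * norm (conformal_factor c (b i) *\<^sub>R b i))"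
      using assms(3) by (intro sum.cong) (simp_all add: abs_mult)
    finally have "sqrt c * norm S \<le> sqrt c * \<dots>"
      using assms(1) by simp
    then show ?thesis
      by (simp add: sum_distrib_left mult.left_commute)
  qed
  also have "\<dots> < T"
    unfolding T_def
  proof (rule sum_strict_mono_ex1)
    show "\<forall>i\<in>{1..N}. \<nu> i * (sqrt c * norm (conformal_factor c (b i) *\<^sub>R b i))
        \<le> \<nu> i * (conformal_factor c (b i) - 1)"
      using assms(3,5) conformal_factor_norm_less[OF assms(1)]
      by (intro ballI mult_left_mono) (auto intro: less_imp_le)
    \<comment> \<open>Strictness of the summed inequality comes from one index of positive
      weight.\<close>
    obtain j where "j \<in> {1..N}" "\<nu> j > 0"
      using assms(3,4) by (metis less_eq_real_def)
    then show "\<exists>i\<in>{1..N}. \<nu> i * (sqrt c * norm (conformal_factor c (b i) *\<^sub>R b i))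
        < \<nu> i * (conformal_factor c (b i) - 1)"
      using conformal_factor_norm_less[OF assms(1) assms(5)]
      by (intro bexI[of _ j] mult_strict_left_mono) auto
  qed simp
  finally have ST: "sqrt c * norm S < T" .
  then have T: "T > 0"
    using assms(1) by (smt (verit) mult_nonneg_nonneg norm_ge_zero real_sqrt_ge_zero)
  \<comment> \<open>So \<open>m\<close> lies in the open ball, where the closed forms for halving
    apply.\<close>
  have "sqrt c * norm m < 1"
    using ST T by (simp add: m_def field_simps)
  then have "(sqrt c * norm m)\<^sup>2 < 1"
    using assms(1) by (simp add: abs_square_less_1)
  then have m: "c * (norm m)\<^sup>2 < 1"
    using assms(1) by (simp add: power_mult_distrib)

  have b_bar: "b_bar = mobius_scale c (1 / 2) m"
    using assms(8) by (simp add: mobius_gyromidpoint_def m_def S_def T_def)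

  have "(\<Sum>i=1..N. (\<nu> i * lorentz_factor c (k i)) *\<^sub>R k i) = S"
    unfolding S_def using lorentz_factor_to_klein(2)[OF assms(1) assms(5)] assms(6)
    by (intro sum.cong) (simp_all flip: scaleR_scaleR)
  moreover have "(\<Sum>i=1..N. \<nu> i * lorentz_factor c (k i)) = T"
    unfolding T_def using lorentz_factor_to_klein(1)[OF assms(1) assms(5)] assms(6)
    by (intro sum.cong) simp_all
  ultimately have k_bar: "k_bar = m"
    using assms(9) by (simp add: einstein_gyromidpoint_def m_def)

  define s where "s = (\<Sum>i=1..N. \<nu> i *\<^sub>R h i)"
  have "s = (T / sqrt c, S)"
    using assms(5,7)
    by (auto simp: s_def S_def T_def prod_eq_iff fst_sum snd_sum sum_divide_distrib
        to_hyperboloid_conformal intro!: sum.cong)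
  moreover have S: "S = T *\<^sub>R m"
    using T by (simp add: m_def)
  ultimately have s: "s = T *\<^sub>R (1 / sqrt c, m)"
    by simp
  \<comment> \<open>The value is negative because \<open>m\<close> lies in the ball, so the absolute
    value in the centroid just flips the sign.\<close>
  have "c * lorentz_inner s s = - (T\<^sup>2 * (1 - c * (norm m)\<^sup>2))"
    using assms(1) unfolding power2_norm_eq_inner
    by (simp add: s lorentz_inner_def algebra_simps power2_eq_square[of T])
  then have "c * \<bar>lorentz_inner s s\<bar> = T\<^sup>2 * (1 - c * (norm m)\<^sup>2)"
    using abs_mult[of c "lorentz_inner s s"] assms(1) m by (simp add: abs_mult)
  then have "sqrt c * sqrt \<bar>lorentz_inner s s\<bar> = T * sqrt (1 - c * (norm m)\<^sup>2)"
    using T by (simp flip: real_sqrt_mult) (simp add: real_sqrt_mult)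
  \<comment> \<open>The factor \<open>T > 0\<close> cancels between \<open>s\<close> and its
    normalisation.\<close>
  then have "h_bar = (lorentz_factor c m / sqrt c, lorentz_factor c m *\<^sub>R m)"
    using T assms(10) unfolding lorentz_centroid_def Let_def s_def[symmetric]
    by (simp add: s lorentz_factor_def divide_inverse mult.commute)
  then have h_bar: "h_bar = to_hyperboloid c b_bar"
    using to_hyperboloid_mobius_half[OF assms(1) m] by (simp add: b_bar)

  have "b_bar \<in> poincare_ball c" and "k_bar = to_klein c b_bar"
    using mobius_half_in_ball[OF assms(1) m] to_klein_mobius_half[OF assms(1) m]
    by (simp_all add: b_bar k_bar)
  moreover have "k_bar \<in> klein_model c"
    using m by (simp add: k_bar klein_model_def)
  ultimately show ?thesis
    using h_bar to_hyperboloid_in_hyperboloid[OF assms(1)] by simp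
qed

end
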